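(* Let $I\subset\{1,\dots,p\}$, $\bar\pi\in\mathcal P^*(I)$ and $T\in\mathcal G_{\bar\pi}$. Then (with $\tilde C_1=C_1$) $$\bar C_{|I|,\bar\pi,T}(Y_I)=\sum_{\{j_G^K\ge1\}_{K\in\mathcal I(T),\,G\in K}}\ \prod_{K\in\mathcal I(T)}\kappa_{\{j_G^K\}_{G\in K}}\ \prod_{G\in\bar\pi}\Bigl(\prod_{K\in\mathcal I_G(T)}\frac{\partial}{\partial\kappa_{j_G^K}}\Bigr)\bigl(\tilde C_{|G|}(Y_G)\bigr),$$ where $Y_I=\{Y_i\}_{i\in I}$, $Y_G=\{Y_i\}_{i\in G}$, and $\partial/\partial\kappa_j$ is the derivative with respect to the first order free cumulant $\kappa_j$.
   Context: $\kappa_{k_1,\dots,k_d}$ ($d\ge1$, $k_i\ge1$) denote the order-$d$ free cumulants, symmetric in their indices, here regarded as commuting formal indeterminates (series in the $Y_i$ have coefficients polynomial in the $\kappa$'s). $C_1(Y)=1+\sum_{a\ge1}\kappa_aY^a$. For permutations $\sigma_1,\sigma_2$ of a finite set with $m$ elements, $\#$ is the number of cycles (or of blocks of a partition), $\Pi(\sigma)$ the partition into cycles, $\vee$ the join of partitions, and the genus is given by $\#(\sigma_1)+\#(\sigma_2)+\#(\sigma_1\sigma_2)-m=2\#(\Pi(\sigma_1)\vee\Pi(\sigma_2))-2g(\sigma_1,\sigma_2)$. For a permutation $\tau$ of a finite set $E$, $\mathrm{NS}(\tau)$ is the set of permutations $\nu$ of $E$ with $g(\nu,\tau)=0$, $\Pi(\tau)\vee\Pi(\nu)$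 the one-block partition of $E$, and such that for any two distinct elements $b,d$ of the same cycle of $\tau$, $\Pi(\tau\circ(b\,d))\vee\Pi(\nu)$ is still the one-block partition (planar non-separable hypermaps). For positive integers $\mu_G=(\mu_i)_{i\in G}$, $\mathrm{NS}(\mu_G)=\mathrm{NS}(\gamma_{\mu_G})$ where $\gamma_{\mu_G}$ is a permutation with exactly one cycle per $i\in G$, of length $\mu_i$. $\mathcal P^*(I)$ is the set of partitions $\bar\pi$ of $I$ other than the partition into singletons. $\mathcal G_{\bar\pi}$ is the set of bipartite trees $T$ whose white vertices are the blocks of $\bar\pi$ and whose other ("blue") vertices have valency at least 2 and form the set $\mathcal I(T)$, each $K\in\mathcal I(T)$ being identified with the set of blocks of $\bar\pi$ adjacent to it (if $\bar\pi$ has one block, the only tree has no blue vertex). $\mathcal I_G(T)=\{K\in\mathcal I(T):G\in K\}$. Define $$\bar C_{|I|,\bar\pi,T}(Y_I)=\sum_{\{\mu_i\ge1\}_{i\in I}}\prod_{i\in I}Y_i^{\mu_i}\sum_{\{\nu_G\in\mathrm{NS}(\mu_G)\}_{G\in\bar\pi}}\ \sum_{\{\mathcal L_G\}_{G\in\bar\pi}}\ \prod_{K\in\mathcal I(T)}\kappa_{\{|\mathcal L_G(K)|\}_{G\in K}}\prod_{G\in\bar\pi}\ \prod_{V\in\Pi(\nu_G)\setminus\mathcal L_G(\mathcal I_G(T))}\kappa_{|V|},$$ where each $\mathcal L_G$ runs over injective maps $\mathcal I_G(T)\to\Pi(\nu_G)$, and for $|G|\ge2$ $$\tilde C_{|G|}(Y_G)=\sum_{\{\mu_i\ge1\}_{i\in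 G}}\prod_{i\in G}Y_i^{\mu_i}\sum_{\nu\in\mathrm{NS}(\mu_G)}\ \prod_{V\in\Pi(\nu)}\kappa_{|V|}.$$ *)

theory Defs
  imports
    Complex_Main
    "HOL-Library.Poly_Mapping"
    "HOL-Library.Multiset"
    "HOL-Library.FuncSet"
    "HOL-Library.Disjoint_Sets"
    "HOL-Combinatorics.Orbits"
begin

section \<open>Polynomials in the free cumulants\<close>

text \<open>
  The free cumulants are formal indeterminates that are symmetric in their indices, so they are
  indexed by multisets of natural numbers: the order is the size of the multiset, and the
  first order cumulants are the ones indexed by \<open>{#k#}\<close>.  Only indeterminates whose index is
  nonempty and has positive entries ever occur below.
\<close>

type_synonym 'r kpoly = "(nat multiset \<Rightarrow>\<^sub>0 nat) \<Rightarrow>\<^sub>0 'r"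

definition kappa :: "nat multiset \<Rightarrow> 'r::comm_ring_1 kpoly" where
  "kappa M = Poly_Mapping.single (Poly_Mapping.single M 1) 1"

text \<open>Formal partial derivative with respect to the first order cumulant of index \<open>j\<close>.  The
  truncated subtraction on exponents is harmless: monomials not containing that cumulant get
  the coefficient 0.\<close>

definition dkappa :: "nat \<Rightarrow> 'r::comm_ring_1 kpoly \<Rightarrow> 'r kpoly" where
  "dkappa j p = (\<Sum>m\<in>Poly_Mapping.keys p.
     Poly_Mapping.single (m - Poly_Mapping.single {#j#} 1)
       (of_nat (Poly_Mapping.lookup m {#j#}) * Poly_Mapping.lookup p m))"


section \<open>Formal power series in the variables \<open>Y\<^sub>i\<close>\<close>

text \<open>A series is its family of coefficients; \<open>m :: nat \<Rightarrow>\<^sub>0 nat\<close> stands for the monomial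
  \<open>\<Prod>i. Y\<^sub>i ^ m i\<close>.\<close>

type_synonym 'r kseries = "(nat \<Rightarrow>\<^sub>0 nat) \<Rightarrow> 'r kpoly"

text \<open>The series \<open>\<Sum>\<mu>. (\<Prod>i\<in>I. Y\<^sub>i ^ \<mu>\<^sub>i) * c \<mu>\<close> over all families \<open>\<mu>\<^sub>i \<ge> 1\<close> (\<open>i \<in> I\<close>),
  for a finite set \<open>I\<close>: exactly the monomials with support \<open>I\<close> occur.\<close>

definition series_pos :: "nat set \<Rightarrow> ((nat \<Rightarrow> nat) \<Rightarrow> 'r::comm_ring_1 kpoly) \<Rightarrow> 'r kseries" where
  "series_pos I c = (\<lambda>m. if Poly_Mapping.keys m = I then c (Poly_Mapping.lookup m) else 0)"

text \<open>Cauchy product of a finite family of series.\<close>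

definition series_prod :: "'a set \<Rightarrow> ('a \<Rightarrow> 'r::comm_ring_1 kseries) \<Rightarrow> 'r kseries" where
  "series_prod A f = (\<lambda>m. \<Sum>d | d \<in> A \<rightarrow>\<^sub>E UNIV \<and> (\<Sum>a\<in>A. d a) = m. \<Prod>a\<in>A. f a (d a))"

definition series_scale :: "'r::comm_ring_1 kpoly \<Rightarrow> 'r kseries \<Rightarrow> 'r kseries" where
  "series_scale c f = (\<lambda>m. c * f m)"

definition series_dkappa :: "nat \<Rightarrow> 'r::comm_ring_1 kseries \<Rightarrow> 'r kseries" where
  "series_dkappa j f = (\<lambda>m. dkappa j (f m))"

text \<open>The (possibly infinite) family \<open>f\<close> over \<open>J\<close> is formally summable, i.e. every monomial
  gets a nonzero coefficient from only finitely many members, and its sum is \<open>s\<close>.\<close>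

definition has_formal_sum :: "('j \<Rightarrow> 'r::comm_ring_1 kseries) \<Rightarrow> 'j set \<Rightarrow> 'r kseries \<Rightarrow> bool" where
  "has_formal_sum f J s \<longleftrightarrow>
     (\<forall>m. finite {j\<in>J. f j m \<noteq> 0} \<and> (\<Sum>j | j \<in> J \<and> f j m \<noteq> 0. f j m) = s m)"


section \<open>Planar non-separable hypermaps\<close>

text \<open>For a permutation of a finite set, \<open>orbit \<sigma> x\<close> is the cycle of \<open>x\<close>; fixed points give
  singleton cycles.\<close>

definition cycle_partition :: "'a set \<Rightarrow> ('a \<Rightarrow> 'a) \<Rightarrow> 'a set set" where
  "cycle_partition E \<sigma> = orbit \<sigma> ` E"

definition partition_join :: "'a set \<Rightarrow> 'a set set \<Rightarrow> 'a set set \<Rightarrow> 'a set set" where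
  "partition_join E P Q = E // (\<Union>B\<in>P \<union> Q. B \<times> B)\<^sup>+"

text \<open>Solved for \<open>g\<close> from
  \<open>#(\<sigma>\<^sub>1) + #(\<sigma>\<^sub>2) + #(\<sigma>\<^sub>1 \<sigma>\<^sub>2) - |E| = 2 #(\<Pi>(\<sigma>\<^sub>1) \<or> \<Pi>(\<sigma>\<^sub>2)) - 2 g\<close>.\<close>

definition genus :: "'a set \<Rightarrow> ('a \<Rightarrow> 'a) \<Rightarrow> ('a \<Rightarrow> 'a) \<Rightarrow> rat" where
  "genus E \<sigma>\<^sub>1 \<sigma>\<^sub>2 =
     (2 * of_nat (card (partition_join E (cycle_partition E \<sigma>\<^sub>1) (cycle_partition E \<sigma>\<^sub>2)))
      + of_nat (card E)
      - of_nat (card (cycle_partition E \<sigma>\<^sub>1))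
      - of_nat (card (cycle_partition E \<sigma>\<^sub>2))
      - of_nat (card (cycle_partition E (\<sigma>\<^sub>1 \<circ> \<sigma>\<^sub>2)))) / 2"

definition NS :: "'a set \<Rightarrow> ('a \<Rightarrow> 'a) \<Rightarrow> ('a \<Rightarrow> 'a) set" where
  "NS E \<tau> = {\<nu>. \<nu> permutes E \<and> genus E \<nu> \<tau> = 0 \<and>
     partition_join E (cycle_partition E \<tau>) (cycle_partition E \<nu>) = {E} \<and>
     (\<forall>C\<in>cycle_partition E \<tau>. \<forall>b\<in>C. \<forall>d\<in>C. b \<noteq> d \<longrightarrow>
        partition_join E (cycle_partition E (\<tau> \<circ> Transposition.transpose b d))
          (cycle_partition E \<nu>) = {E})}"

text \<open>The standard representative \<open>\<gamma>\<^sub>\<mu>\<close>: on the points \<open>(i, a)\<close> with \<open>i \<in> G\<close>, \<open>a < \<mu>\<^sub>i\<close>, it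
  rotates, for each \<open>i\<close>, the \<open>\<mu>\<^sub>i\<close> points with first component \<open>i\<close>.\<close>

definition pts :: "nat set \<Rightarrow> (nat \<Rightarrow> nat) \<Rightarrow> (nat \<times> nat) set" where
  "pts G \<mu> = Sigma G (\<lambda>i. {..<\<mu> i})"

definition gamma :: "nat set \<Rightarrow> (nat \<Rightarrow> nat) \<Rightarrow> nat \<times> nat \<Rightarrow> nat \<times> nat" where
  "gamma G \<mu> x = (if x \<in> pts G \<mu> then (fst x, Suc (snd x) mod \<mu> (fst x)) else x)"

definition NSmu :: "nat set \<Rightarrow> (nat \<Rightarrow> nat) \<Rightarrow> (nat \<times> nat \<Rightarrow> nat \<times> nat) set" where
  "NSmu G \<mu> = NS (pts G \<mu>) (gamma G \<mu>)"


section \<open>Partitions and bipartite trees\<close>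

definition nontrivial_partitions :: "'a set \<Rightarrow> 'a set set set" where
  "nontrivial_partitions I = {\<pi>. partition_on I \<pi> \<and> \<pi> \<noteq> (\<lambda>i. {i}) ` I}"

text \<open>Undirected simple graphs, given by a vertex set and a symmetric adjacency relation.\<close>

definition connected_graph :: "'v set \<Rightarrow> ('v \<times> 'v) set \<Rightarrow> bool" where
  "connected_graph V A \<longleftrightarrow> V \<noteq> {} \<and> (\<forall>u\<in>V. \<forall>v\<in>V. (u, v) \<in> A\<^sup>*)"

definition graph_cycle :: "('v \<times> 'v) set \<Rightarrow> 'v list \<Rightarrow> bool" where
  "graph_cycle A vs \<longleftrightarrow> length vs \<ge> 3 \<and> distinct vs \<and>
     (\<forall>i < length vs. (vs ! i, vs ! (Suc i mod length vs)) \<in> A)"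

definition tree_graph :: "'v set \<Rightarrow> ('v \<times> 'v) set \<Rightarrow> bool" where
  "tree_graph V A \<longleftrightarrow> connected_graph V A \<and> (\<nexists>vs. graph_cycle A vs)"

text \<open>A bipartite graph is given by its white vertices \<open>\<pi>\<close> and its set \<open>T\<close> of blue vertices,
  where each blue vertex is the set of white vertices adjacent to it.\<close>

definition bip_verts :: "'a set \<Rightarrow> 'a set set \<Rightarrow> ('a + 'a set) set" where
  "bip_verts \<pi> T = \<pi> <+> T"

definition bip_adj :: "'a set \<Rightarrow> 'a set set \<Rightarrow> (('a + 'a set) \<times> ('a + 'a set)) set" where
  "bip_adj \<pi> T =
     {(Inl G, Inr K) | G K. G \<in> \<pi> \<and> K \<in> T \<and> G \<in> K} \<union>
     {(Inr K, Inl G) | G K. G \<in> \<pi> \<and> K \<in> T \<and> G \<in> K}"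

definition bip_trees :: "'a set \<Rightarrow> 'a set set set" where
  "bip_trees \<pi> = {T. (\<forall>K\<in>T. K \<subseteq> \<pi> \<and> card K \<ge> 2) \<and> tree_graph (bip_verts \<pi> T) (bip_adj \<pi> T)}"

definition blue_at :: "'a set set \<Rightarrow> 'a \<Rightarrow> 'a set set" where
  "blue_at T G = {K\<in>T. G \<in> K}"


section \<open>The generating series\<close>

definition C1 :: "nat \<Rightarrow> 'r::comm_ring_1 kseries" where
  "C1 i = (\<lambda>m. if m = 0 then 1
     else if Poly_Mapping.keys m = {i} then kappa {#Poly_Mapping.lookup m i#} else 0)"

definition Ctilde :: "nat set \<Rightarrow> 'r::comm_ring_1 kseries" where
  "Ctilde G = (if card G = 1 then C1 (the_elem G)
     else series_pos G (\<lambda>\<mu>. \<Sum>\<nu>\<in>NSmu G \<mu>. \<Prod>V\<in>cycle_partition (pts G \<mu>) \<nu>. kappa {#card V#}))"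

definition Cbar :: "nat set \<Rightarrow> nat set set \<Rightarrow> nat set set set \<Rightarrow> 'r::comm_ring_1 kseries" where
  "Cbar I \<pi> T = series_pos I (\<lambda>\<mu>.
     \<Sum>\<nu> \<in> (\<Pi>\<^sub>E G\<in>\<pi>. NSmu G \<mu>).
     \<Sum>L \<in> (\<Pi>\<^sub>E G\<in>\<pi>. {l \<in> blue_at T G \<rightarrow>\<^sub>E cycle_partition (pts G \<mu>) (\<nu> G). inj_on l (blue_at T G)}).
       (\<Prod>K\<in>T. kappa (image_mset (\<lambda>G. card (L G K)) (mset_set K))) *
       (\<Prod>G\<in>\<pi>. \<Prod>V \<in> cycle_partition (pts G \<mu>) (\<nu> G) - L G ` blue_at T G. kappa {#card V#}))"

text \<open>The families \<open>{j\<^sub>G\<^sup>K \<ge> 1}\<close> indexed by the edges \<open>(K, G)\<close> of the tree.\<close>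

definition edge_labels :: "'a set set \<Rightarrow> ('a set \<times> 'a \<Rightarrow> nat) set" where
  "edge_labels T = (SIGMA K:T. K) \<rightarrow>\<^sub>E {1..}"

text \<open>Composition of the commuting operators \<open>\<partial>/\<partial>\<kappa>\<close> of indices \<open>j K\<close>, \<open>K \<in> S\<close>, for finite \<open>S\<close>.\<close>

definition series_dkappas :: "'k set \<Rightarrow> ('k \<Rightarrow> nat) \<Rightarrow> 'r::comm_ring_1 kseries \<Rightarrow> 'r kseries" where
  "series_dkappas S j f = Finite_Set.fold (\<lambda>K. series_dkappa (j K)) f S"

end

theory Submission
  imports Defs
begin

text \<open>
  The identity holds term by term once both sides are expanded over the same combinatorial objects.
  A coefficient of \<open>Ctilde\<close> at a monomial of full support is a sum, over planar non-separable
  hypermaps \<open>\<nu>\<close>, of the product of the first order cumulants \<open>\<kappa>\<^bsub>|V|\<^esub>\<close> over the cycles \<open>V\<close> of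
  \<open>\<nu>\<close>.  Deriving such a product with respect to \<open>\<kappa>\<^bsub>j K\<^esub>\<close> for all \<open>K\<close> adjacent to the white vertex
  chooses distinct cycles of lengths \<open>j K\<close> and erases their weights
  (\<open>series_dkappas_sum_prod_kappa\<close>): it produces exactly the injective maps \<open>L\<^sub>G\<close> with
  \<open>|L\<^sub>G(K)| = j K\<close>.  The blocks of \<open>\<pi>\<close> involve disjoint sets of variables, so the product over
  \<open>G\<close> multiplies single coefficients (\<open>series_prod_disjoint_supports\<close>).  Summing over all
  families \<open>j\<close> then lifts the constraint on the lengths: each family of maps \<open>L\<close> occurs for precisely
  one \<open>j\<close>, the family of lengths of the chosen cycles, and the factors \<open>\<kappa>\<close> attached to the blue
  vertices match for this \<open>j\<close> (\<open>sum_fibers\<close>).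

  Singleton blocks are the delicate point, because for them \<open>C\<^sub>1\<close> is prescribed instead of a sum over
  hypermaps.  Its constant term is removed by the derivatives, of which there is at least one
  (\<open>blue_at_nonempty_or_card\<close>).  Its other coefficients have the hypermap form because the only
  planar non-separable hypermap over a single cycle \<open>\<tau>\<close> is \<open>\<tau>\<inverse>\<close> (\<open>NS_single_cycle_imp_inv\<close>).  The
  latter rests on the nonnegativity of the genus (\<open>cycles_genus_bound\<close>), proved by splitting cycles
  with transpositions.
\<close>

section \<open>Cycles and transpositions\<close>

lemma orbit_closed_subset:
  assumes "f x \<in> S" and "\<And>y. y \<in> S \<Longrightarrow> f y \<in> S"
  shows "orbit f x \<subseteq> S"
proof
  fix y assume "y \<in> orbit f x"
  then show "y \<in> S" by induct (use assms in auto)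
qed

context
  fixes E :: "'a set" and f :: "'a \<Rightarrow> 'a"
  assumes fin: "finite E" and perm: "f permutes E"
begin

lemma perm_self_in_orbit: "x \<in> orbit f x"
  using fin perm by (blast intro: permutation_self_in_orbit permutes_imp_permutation)

lemma perm_orbit_eq: "y \<in> orbit f x \<Longrightarrow> orbit f y = orbit f x"
  using cyclic_on_orbit[OF perm fin] by (metis orbit_cyclic_eq3)

lemma perm_orbit_eq_iff: "orbit f y = orbit f x \<longleftrightarrow> y \<in> orbit f x"
  using perm_orbit_eq perm_self_in_orbit by metis

lemma card_cycle_partition_le: "card (cycle_partition E f) \<le> card E"
  using fin by (simp add: cycle_partition_def card_image_le)

lemma cycle_partition_subset:
  assumes "V \<in> cycle_partition E f"
  shows "V \<subseteq> E"
  using assms perm by (auto simp: cycle_partition_def dest: permutes_orbit_subset)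

lemma card_cycle_pos:
  assumes "V \<in> cycle_partition E f"
  shows "card V > 0"
proof -
  have "finite V" using assms cycle_partition_subset fin finite_subset by blast
  moreover have "V \<noteq> {}" using assms orbit_nonempty[of f] by (auto simp: cycle_partition_def)
  ultimately show ?thesis by (simp add: card_gt_0_iff)
qed

lemma perm_comp_transpose:
  assumes "b \<in> E" "d \<in> E"
  shows "f \<circ> Transposition.transpose b d permutes E"
  using assms perm by (intro permutes_compose permutes_swap_id)

text \<open>Composing with the transposition redirects \<open>d\<close> to \<open>f b\<close> and leaves the rest of the cycle of
  \<open>b\<close> alone, so from \<open>d\<close> one walks through that whole cycle, ending in \<open>b\<close>.\<close>

lemma transpose_reaches_other_cycle:
  assumes "d \<notin> orbit f b"
  shows "orbit f b \<subseteq> orbit (f \<circ> Transposition.transpose b d) d"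
proof
  let ?g = "f \<circ> Transposition.transpose b d"
  have gd: "?g d = f b" by simp
  fix x assume "x \<in> orbit f b"
  then show "x \<in> orbit ?g d"
  proof induct
    case base
    show ?case using orbit.base[of ?g d] by (simp only: gd)
  next
    case (step y)
    show ?case
    proof (cases "y = b")
      case True
      then show ?thesis using orbit.base[of ?g d] by (simp only: gd)
    next
      case False
      then have "?g y = f y" using step(1) assms by (auto simp: Transposition.transpose_def)
      then show ?thesis using orbit.step[OF step(2)] by (simp only:)
    qed
  qed
qed

end

text \<open>Points of different cycles: by the preceding lemma, used in both directions, the two cycles of
  \<open>f\<close> are joined into one, and the permutation is unchanged elsewhere.\<close>

lemma card_cycles_merge:
  assumes fin: "finite E" and perm: "f permutes E" and E: "b \<in> E" "d \<in> E"
    and bd: "d \<notin> orbit f b"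
  shows "card (cycle_partition E f) = Suc (card (cycle_partition E (f \<circ> Transposition.transpose b d)))"
proof -
  let ?g = "f \<circ> Transposition.transpose b d"
  define B D where "B = orbit f b" and "D = orbit f d"
  have g: "?g permutes E" using perm_comp_transpose[OF fin perm E] .
  note self = perm_self_in_orbit[OF fin perm]
  note eq = perm_orbit_eq[OF fin perm]
  have db: "b \<notin> orbit f d" using bd eq self by metis
  have disj: "B \<inter> D = {}"
  proof (rule ccontr)
    assume "B \<inter> D \<noteq> {}"
    then obtain x where "x \<in> orbit f b" "x \<in> orbit f d" by (auto simp: B_def D_def)
    then show False using bd eq self by metis
  qed
  have Bd: "B \<subseteq> orbit ?g d"
    unfolding B_def using transpose_reaches_other_cycle[OF fin perm bd] .
  have Db: "D \<subseteq> orbit ?g b"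
    unfolding D_def using transpose_reaches_other_cycle[OF fin perm db]
    by (simp add: transpose_commute)
  have bB: "b \<in> B" and dD: "d \<in> D" using self by (auto simp: B_def D_def)
  have same: "orbit ?g b = orbit ?g d"
    using perm_orbit_eq[OF fin g] Bd bB by blast
  have fB: "f y \<in> B" if "y \<in> B" for y using that by (auto simp: B_def intro: orbit.step)
  have fD: "f y \<in> D" if "y \<in> D" for y using that by (auto simp: D_def intro: orbit.step)
  have step: "?g y \<in> B \<union> D" if "y \<in> B \<union> D" for y
    using that fB fD bB dD by (auto simp: Transposition.transpose_def)
  have gb: "orbit ?g b = B \<union> D"
  proof
    show "orbit ?g b \<subseteq> B \<union> D" by (rule orbit_closed_subset, rule step) (use bB step in blast)+
    show "B \<union> D \<subseteq> orbit ?g b" using Bd Db same by auto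
  qed
  have other: "orbit ?g x = orbit f x" if "x \<notin> B \<union> D" for x
  proof (rule orbit_cong[OF self])
    fix s assume "s \<in> orbit f x"
    then have "b \<noteq> s" "d \<noteq> s" using that eq self unfolding B_def D_def by (metis Un_iff)+
    then show "?g s = f s" by simp
  qed
  have inBD: "orbit ?g x = B \<union> D" if "x \<in> B \<union> D" for x
    using that gb perm_orbit_eq[OF fin g] by metis
  have BD_E: "B \<subseteq> E" "D \<subseteq> E"
    using perm E by (auto simp: B_def D_def dest: permutes_orbit_subset)
  let ?R = "orbit f ` (E - (B \<union> D))"
  have Pg: "cycle_partition E ?g = insert (B \<union> D) ?R"
  proof -
    have "cycle_partition E ?g = orbit ?g ` (B \<union> D) \<union> orbit ?g ` (E - (B \<union> D))"
      using BD_E by (auto simp: cycle_partition_def)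
    also have "orbit ?g ` (B \<union> D) = {B \<union> D}" using inBD bB by auto
    also have "orbit ?g ` (E - (B \<union> D)) = ?R" using other by (intro image_cong) auto
    finally show ?thesis by (simp only: insert_is_Un[symmetric])
  qed
  have Pf: "cycle_partition E f = insert B (insert D ?R)"
  proof -
    have "cycle_partition E f = orbit f ` B \<union> orbit f ` D \<union> ?R"
      using BD_E by (auto simp: cycle_partition_def)
    also have "orbit f ` B = {B}" using bB eq[of _ b, folded B_def] by auto
    also have "orbit f ` D = {D}" using dD eq[of _ d, folded D_def] by auto
    finally show ?thesis by (simp add: insert_commute)
  qed
  have "B \<notin> ?R" "D \<notin> ?R" "B \<union> D \<notin> ?R"
    using self bB dD by blast+
  moreover have "B \<noteq> D" using disj bB by blast
  moreover have "finite ?R" using fin by blast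
  ultimately show "card (cycle_partition E f) = Suc (card (cycle_partition E ?g))"
    unfolding Pf Pg by (metis card_insert_disjoint finite_insert insert_iff)
qed

text \<open>If \<open>d = f\<^sup>k b\<close> with \<open>k \<ge> 1\<close> minimal, the arc \<open>f b, f\<^sup>2 b, \<dots>, f\<^sup>k b = d\<close> omits \<open>b\<close> and is closed
  up by the transposition, which sends \<open>d\<close> back to \<open>f b\<close>.\<close>

lemma transpose_separates_cycle:
  assumes fin: "finite E" and perm: "f permutes E" and bd: "d \<in> orbit f b" "b \<noteq> d"
  shows "b \<notin> orbit (f \<circ> Transposition.transpose b d) d"
proof -
  let ?g = "f \<circ> Transposition.transpose b d"
  define k where "k = (LEAST k. 0 < k \<and> (f ^^ k) b = d)"
  have ex: "\<exists>k. 0 < k \<and> (f ^^ k) b = d" using bd(1) by (auto simp: orbit_altdef)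
  have k: "0 < k" "(f ^^ k) b = d" using LeastI_ex[OF ex] by (auto simp: k_def)
  have least: "(f ^^ i) b \<noteq> d" if "0 < i" "i < k" for i
    using not_less_Least[of i "\<lambda>k. 0 < k \<and> (f ^^ k) b = d"] that unfolding k_def by blast
  define S where "S = {(f ^^ i) b | i. 0 < i \<and> i \<le> k}"
  have bS: "b \<notin> S"
  proof
    assume "b \<in> S"
    then have "\<exists>i. b = (f ^^ i) b \<and> 0 < i \<and> i \<le> k" unfolding S_def by (rule CollectD)
    then obtain i where "b = (f ^^ i) b" "0 < i" "i \<le> k" by (elim exE conjE)
    note i = this(1)[symmetric] this(2,3)
    have "i \<noteq> k" using i k bd by auto
    have "(f ^^ (k - i)) b = (f ^^ (k - i)) ((f ^^ i) b)" using i by simp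
    also have "\<dots> = (f ^^ (k - i + i)) b" by (simp add: funpow_add del: le_add_diff_inverse2)
    also have "\<dots> = d" using i k by simp
    finally have "(f ^^ (k - i)) b = d" .
    moreover have "0 < k - i" "k - i < k" using i \<open>i \<noteq> k\<close> by auto
    ultimately show False using least by blast
  qed
  have fb: "f b \<in> S" using k(1) by (auto simp: S_def intro!: exI[of _ 1])
  have "?g y \<in> S" if y: "y \<in> S" for y
  proof (cases "y = d")
    case True
    then show ?thesis using fb by simp
  next
    case False
    from y obtain i where i: "y = (f ^^ i) b" "0 < i" "i \<le> k" by (auto simp: S_def)
    have "i < k" using i k False by (metis le_neq_implies_less)
    have "y \<noteq> b" using y bS by blast
    then have "?g y = f y" using False by simp
    also have "\<dots> = (f ^^ Suc i) b" using i by simp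
    finally show ?thesis using \<open>i < k\<close> unfolding S_def by (auto intro!: exI[of _ "Suc i"])
  qed
  moreover have "?g d \<in> S" using fb by simp
  ultimately have "orbit ?g d \<subseteq> S" by (intro orbit_closed_subset)
  then show ?thesis using bS by auto
qed

text \<open>The transposition separates \<open>b\<close> from \<open>d\<close>; applying it once more merges them again, so the
  merging lemma for the composed permutation gives the count.\<close>

lemma card_cycles_split:
  assumes fin: "finite E" and perm: "f permutes E" and E: "b \<in> E" "d \<in> E"
    and bd: "d \<in> orbit f b" "b \<noteq> d"
  shows "card (cycle_partition E (f \<circ> Transposition.transpose b d)) = Suc (card (cycle_partition E f))"
proof -
  let ?g = "f \<circ> Transposition.transpose b d"
  have g: "?g permutes E" using perm_comp_transpose[OF fin perm E] .
  have "d \<notin> orbit ?g b"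
    using transpose_separates_cycle[OF fin perm bd] perm_orbit_eq_iff[OF fin g] 
      perm_self_in_orbit[OF fin g] by metis
  from card_cycles_merge[OF fin g E this] show ?thesis by (simp add: comp_assoc)
qed

section \<open>Nonnegativity of the genus\<close>

text \<open>The set \<open>X\<close> meets every orbit of the group generated by \<open>\<sigma>\<close> and \<open>\<tau>\<close>, that is, every block of
  \<open>\<Pi>(\<sigma>) \<or> \<Pi>(\<tau>)\<close>.  Formulating this through invariant subsets, and bounding by the size of
  such an \<open>X\<close>, avoids tracking how the number of blocks of the join changes.\<close>

definition touches_all_classes :: "'a set \<Rightarrow> ('a \<Rightarrow> 'a) \<Rightarrow> ('a \<Rightarrow> 'a) \<Rightarrow> 'a set \<Rightarrow> bool" where
  "touches_all_classes E \<sigma> \<tau> X \<longleftrightarrow>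
     (\<forall>S\<subseteq>E. X \<subseteq> S \<longrightarrow> \<sigma> ` S \<subseteq> S \<longrightarrow> \<tau> ` S \<subseteq> S \<longrightarrow> S = E)"

text \<open>With \<open>X\<close> a transversal of the join, this says that the genus is nonnegative.  The induction
  splits cycles of \<open>\<tau>\<close> until \<open>\<tau> = id\<close>, where the bound only says that every cycle of \<open>\<sigma>\<close> meets
  \<open>X\<close>.  One splitting by \<open>(b d)\<close> adds a cycle to \<open>\<tau>\<close>.  If \<open>b\<close> and \<open>d\<close> are still connected
  afterwards, \<open>X\<close> remains valid and \<open>\<sigma>\<tau>\<close> changes by at most one cycle.  Otherwise \<open>b\<close> and
  \<open>d\<close> lie in different cycles of the new product, so \<open>\<sigma>\<tau>\<close> had one cycle less; the left-hand side
  grows by two, which pays for one new element of \<open>X\<close>.\<close>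

lemma cycles_genus_bound:
  assumes fin: "finite E" and \<sigma>: "\<sigma> permutes E"
  shows "\<tau> permutes E \<Longrightarrow> X \<subseteq> E \<Longrightarrow> touches_all_classes E \<sigma> \<tau> X \<Longrightarrow>
    card (cycle_partition E \<sigma>) + card (cycle_partition E \<tau>) + card (cycle_partition E (\<sigma> \<circ> \<tau>))
      \<le> card E + 2 * card X"
proof (induction "card E - card (cycle_partition E \<tau>)" arbitrary: \<tau> X rule: less_induct)
  case less
  note \<tau> = less.prems(1) and X = less.prems(2) and touch = less.prems(3)
  have finX: "finite X" using X fin finite_subset by blast
  note touchD = touch[unfolded touches_all_classes_def, rule_format]
  show ?case
  proof (cases "\<tau> = id")
    case True
    define S where "S = (\<Union>x\<in>X. orbit \<sigma> x)"
    have "S = E"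
    proof (rule touchD)
      show "S \<subseteq> E" using X \<sigma> by (auto simp: S_def dest: permutes_orbit_subset)
      show "X \<subseteq> S" using perm_self_in_orbit[OF fin \<sigma>] by (auto simp: S_def)
      show "\<sigma> ` S \<subseteq> S" by (auto simp: S_def intro: orbit.step)
      show "\<tau> ` S \<subseteq> S" by (simp add: True)
    qed
    have "cycle_partition E \<sigma> \<subseteq> orbit \<sigma> ` X"
    proof
      fix V assume "V \<in> cycle_partition E \<sigma>"
      then obtain e where "e \<in> E" "V = orbit \<sigma> e" by (auto simp: cycle_partition_def)
      then obtain x where "x \<in> X" "e \<in> orbit \<sigma> x" using \<open>S = E\<close> by (auto simp: S_def)
      then show "V \<in> orbit \<sigma> ` X"
        using perm_orbit_eq[OF fin \<sigma>] \<open>V = orbit \<sigma> e\<close> by auto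
    qed
    then have "card (cycle_partition E \<sigma>) \<le> card (orbit \<sigma> ` X)"
      using finX by (intro card_mono) auto
    also have "\<dots> \<le> card X" using finX by (rule card_image_le)
    finally have "card (cycle_partition E \<sigma>) \<le> card X" .
    moreover have "card (cycle_partition E \<tau>) \<le> card E"
      using card_cycle_partition_le[OF fin \<tau>] .
    ultimately show ?thesis by (simp add: True)
  next
    case False
    then obtain b where b: "\<tau> b \<noteq> b" by (auto simp: fun_eq_iff)
    define d where "d = \<tau> b"
    have bE: "b \<in> E" using b \<tau> by (auto simp: permutes_def)
    have dE: "d \<in> E" using bE \<tau> by (simp add: d_def permutes_in_image)
    have bd: "b \<noteq> d" using b by (simp add: d_def)
    define \<tau>' where "\<tau>' = \<tau> \<circ> Transposition.transpose b d"
    have \<tau>': "\<tau>' permutes E" unfolding \<tau>'_def using perm_comp_transpose[OF fin \<tau> bE dE] .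
    have card': "card (cycle_partition E \<tau>') = Suc (card (cycle_partition E \<tau>))"
      unfolding \<tau>'_def using bd
      by (intro card_cycles_split[OF fin \<tau> bE dE]) (auto simp: d_def intro: orbit.base)
    have smaller: "card E - card (cycle_partition E \<tau>') < card E - card (cycle_partition E \<tau>)"
      using card' card_cycle_partition_le[OF fin \<tau>'] by simp
    have \<tau>_eq: "\<tau> = \<tau>' \<circ> Transposition.transpose b d" by (simp add: \<tau>'_def comp_assoc)
    have \<sigma>\<tau>': "\<sigma> \<circ> \<tau>' permutes E" using \<sigma> \<tau>' by (rule permutes_compose[rotated])
    have \<sigma>\<tau>_eq: "\<sigma> \<circ> \<tau> = (\<sigma> \<circ> \<tau>') \<circ> Transposition.transpose b d" by (simp add: \<tau>_eq comp_assoc)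
    \<comment> \<open>Sets stable under \<open>\<tau>'\<close> that do not distinguish \<open>b\<close> from \<open>d\<close> are stable under \<open>\<tau>\<close>.\<close>
    have stable: "\<tau> ` S \<subseteq> S" if "\<tau>' ` S \<subseteq> S" "b \<in> S \<longleftrightarrow> d \<in> S" for S
      using that unfolding \<tau>_eq by (auto simp: Transposition.transpose_def)
    show ?thesis
    proof (cases "\<forall>S\<subseteq>E. \<sigma> ` S \<subseteq> S \<longrightarrow> \<tau>' ` S \<subseteq> S \<longrightarrow> (b \<in> S \<longleftrightarrow> d \<in> S)")
      case True
      have "touches_all_classes E \<sigma> \<tau>' X"
        unfolding touches_all_classes_def
      proof (intro allI impI)
        fix S assume S: "S \<subseteq> E" "X \<subseteq> S" "\<sigma> ` S \<subseteq> S" "\<tau>' ` S \<subseteq> S"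
        then have "b \<in> S \<longleftrightarrow> d \<in> S" using True by simp
        then show "S = E" using S stable by (intro touchD) simp_all
      qed
      from less.hyps[OF smaller \<tau>' X this]
      have "card (cycle_partition E \<sigma>) + Suc (card (cycle_partition E \<tau>)) +
          card (cycle_partition E (\<sigma> \<circ> \<tau>')) \<le> card E + 2 * card X" using card' by simp
      moreover have "card (cycle_partition E (\<sigma> \<circ> \<tau>)) \<le> Suc (card (cycle_partition E (\<sigma> \<circ> \<tau>')))"
      proof (cases "d \<in> orbit (\<sigma> \<circ> \<tau>') b")
        case True
        then show ?thesis
          unfolding \<sigma>\<tau>_eq using card_cycles_split[OF fin \<sigma>\<tau>' bE dE] bd by simp
      next
        case False
        then show ?thesis
          unfolding \<sigma>\<tau>_eq using card_cycles_merge[OF fin \<sigma>\<tau>' bE dE] by simp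
      qed
      ultimately show ?thesis by linarith
    next
      case False
      then obtain S where S: "S \<subseteq> E" "\<sigma> ` S \<subseteq> S" "\<tau>' ` S \<subseteq> S" "(b \<in> S) \<noteq> (d \<in> S)" by blast
      have sub: "orbit (\<sigma> \<circ> \<tau>') x \<subseteq> S" if "x \<in> S" for x
        using S(2,3) that by (intro orbit_closed_subset) (simp_all add: image_subset_iff)
      have "d \<notin> orbit (\<sigma> \<circ> \<tau>') b"
      proof
        assume "d \<in> orbit (\<sigma> \<circ> \<tau>') b"
        moreover from this have "b \<in> orbit (\<sigma> \<circ> \<tau>') d"
          using perm_orbit_eq_iff[OF fin \<sigma>\<tau>'] perm_self_in_orbit[OF fin \<sigma>\<tau>'] by metis
        ultimately show False using sub S(4) by blast
      qed
      then have merge: "card (cycle_partition E (\<sigma> \<circ> \<tau>')) = Suc (card (cycle_partition E (\<sigma> \<circ> \<tau>)))"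
        unfolding \<sigma>\<tau>_eq using card_cycles_merge[OF fin \<sigma>\<tau>' bE dE] by simp
      \<comment> \<open>One of \<open>b\<close>, \<open>d\<close> suffices as the new element: if both failed, the intersection of the two
        witnessing invariant sets would avoid \<open>b\<close> and \<open>d\<close>, hence be proper and stable under \<open>\<tau>\<close>.\<close>
      have "\<exists>x\<in>E. touches_all_classes E \<sigma> \<tau>' (insert x X)"
      proof (rule ccontr)
        assume contra: "\<not> ?thesis"
        then have "\<not> touches_all_classes E \<sigma> \<tau>' (insert b X)" "\<not> touches_all_classes E \<sigma> \<tau>' (insert d X)"
          using bE dE by auto
        then obtain S1 S2
          where S1: "S1 \<subseteq> E" "insert b X \<subseteq> S1" "\<sigma> ` S1 \<subseteq> S1" "\<tau>' ` S1 \<subseteq> S1" "S1 \<noteq> E"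
            and S2: "S2 \<subseteq> E" "insert d X \<subseteq> S2" "\<sigma> ` S2 \<subseteq> S2" "\<tau>' ` S2 \<subseteq> S2" "S2 \<noteq> E"
          unfolding touches_all_classes_def by metis
        have "\<not> (b \<in> S1 \<longleftrightarrow> d \<in> S1)" using touchD[of S1] stable[of S1] S1 by auto
        then have d1: "d \<notin> S1" using S1 by auto
        have "\<not> (b \<in> S2 \<longleftrightarrow> d \<in> S2)" using touchD[of S2] stable[of S2] S2 by auto
        then have b2: "b \<notin> S2" using S2 by auto
        have "S1 \<inter> S2 = E"
        proof (rule touchD)
          show "S1 \<inter> S2 \<subseteq> E" "X \<subseteq> S1 \<inter> S2" using S1(1,2) S2(1,2) by auto
          show "\<sigma> ` (S1 \<inter> S2) \<subseteq> S1 \<inter> S2" using S1(3) S2(3) by auto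
          show "\<tau> ` (S1 \<inter> S2) \<subseteq> S1 \<inter> S2"
            using S1(4) S2(4) d1 b2 by (intro stable) auto
        qed
        then show False using b2 bE by auto
      qed
      then obtain x where x: "x \<in> E" "touches_all_classes E \<sigma> \<tau>' (insert x X)" by blast
      have "insert x X \<subseteq> E" using x X by auto
      from less.hyps[OF smaller \<tau>' this x(2)] card' merge
      have "card (cycle_partition E \<sigma>) + Suc (card (cycle_partition E \<tau>)) +
          Suc (card (cycle_partition E (\<sigma> \<circ> \<tau>))) \<le> card E + 2 * card (insert x X)" by simp
      moreover have "card (insert x X) \<le> Suc (card X)" using finX by (simp add: card_insert_if)
      ultimately show ?thesis by linarith
    qed
  qed
qed

lemma connected_touches_all_classes:
  assumes fin: "finite E" and \<sigma>: "\<sigma> permutes E" and \<tau>: "\<tau> permutes E" and x: "x \<in> E"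
    and join: "partition_join E (cycle_partition E \<tau>) (cycle_partition E \<sigma>) = {E}"
  shows "touches_all_classes E \<sigma> \<tau> {x}"
  unfolding touches_all_classes_def
proof (intro allI impI)
  fix S assume S: "S \<subseteq> E" "{x} \<subseteq> S" "\<sigma> ` S \<subseteq> S" "\<tau> ` S \<subseteq> S"
  define R where "R = (\<Union>B\<in>cycle_partition E \<tau> \<union> cycle_partition E \<sigma>. B \<times> B)"
  have step: "v \<in> S" if "(u, v) \<in> R" "u \<in> S" for u v
  proof -
    from that obtain f e where f: "f = \<sigma> \<or> f = \<tau>" and uv: "u \<in> orbit f e" "v \<in> orbit f e"
      by (auto simp: R_def cycle_partition_def)
    have "f permutes E" using f \<sigma> \<tau> by auto
    then have "v \<in> orbit f u" using perm_orbit_eq[OF fin] uv by metis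
    moreover have "orbit f u \<subseteq> S" using f S \<open>u \<in> S\<close> by (intro orbit_closed_subset) auto
    ultimately show ?thesis by auto
  qed
  have "v \<in> S" if "(x, v) \<in> R\<^sup>+" for v
    using that by (induct rule: trancl_induct) (use step S in auto)
  moreover have "R\<^sup>+ `` {x} = E"
    using join quotientI[OF x, of "R\<^sup>+"] by (simp add: partition_join_def R_def)
  ultimately show "S = E" using S by blast
qed

lemma connected_cycles_bound:
  assumes fin: "finite E" and \<sigma>: "\<sigma> permutes E" and \<tau>: "\<tau> permutes E" and "E \<noteq> {}"
    and join: "partition_join E (cycle_partition E \<tau>) (cycle_partition E \<sigma>) = {E}"
  shows "card (cycle_partition E \<sigma>) + card (cycle_partition E \<tau>) + card (cycle_partition E (\<sigma> \<circ> \<tau>))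
      \<le> card E + 2"
proof -
  obtain x where x: "x \<in> E" using assms by auto
  then show ?thesis
    using cycles_genus_bound[OF fin \<sigma> \<tau>, of "{x}"] connected_touches_all_classes[OF fin \<sigma> \<tau> x join]
    by simp
qed

section \<open>Non-separable hypermaps on one cycle\<close>

lemma partition_join_whole:
  assumes "E \<noteq> {}" and "P \<union> Q \<subseteq> Pow E" and "E \<in> P \<union> Q"
  shows "partition_join E P Q = {E}"
proof -
  have "(\<Union>B\<in>P \<union> Q. B \<times> B) = E \<times> E" using assms by auto
  moreover have "(E \<times> E)\<^sup>+ = E \<times> E" by (intro trancl_id) (auto simp: trans_def)
  ultimately show ?thesis using assms(1) by (auto simp: partition_join_def quotient_def)
qed

text \<open>Suppose \<open>\<nu>\<tau>\<close> moves \<open>b\<close> to \<open>d \<noteq> b\<close>.  Then \<open>b\<close> and \<open>d\<close> share a cycle both of \<open>\<nu>\<tau>\<close> and of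
  \<open>\<tau>\<close>, so replacing \<open>\<tau>\<close> by \<open>\<tau>(b d)\<close> adds a cycle to each.  Since \<open>\<nu>\<close> and \<open>\<tau>\<close> had genus 0, the
  pair \<open>\<nu>\<close>, \<open>\<tau>(b d)\<close>, which non-separability keeps connected, would have negative genus.\<close>

lemma NS_single_cycle_imp_inv:
  assumes fin: "finite E" and \<tau>: "\<tau> permutes E" and one: "cycle_partition E \<tau> = {E}"
    and NS: "\<nu> \<in> NS E \<tau>"
  shows "\<nu> = inv \<tau>"
proof -
  have ne: "E \<noteq> {}" using one by (auto simp: cycle_partition_def)
  have \<nu>: "\<nu> permutes E" and g0: "genus E \<nu> \<tau> = 0"
    and nonsep: "\<And>C b d. C \<in> cycle_partition E \<tau> \<Longrightarrow> b \<in> C \<Longrightarrow> d \<in> C \<Longrightarrow> b \<noteq> d \<Longrightarrow>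
        partition_join E (cycle_partition E (\<tau> \<circ> Transposition.transpose b d))
          (cycle_partition E \<nu>) = {E}"
    using NS by (simp_all add: NS_def)
  have \<nu>\<tau>: "\<nu> \<circ> \<tau> permutes E" using \<tau> \<nu> by (rule permutes_compose)
  have "partition_join E (cycle_partition E \<nu>) (cycle_partition E \<tau>) = {E}"
    using one ne cycle_partition_subset[OF fin \<nu>] cycle_partition_subset[OF fin \<tau>]
    by (intro partition_join_whole) auto
  then have "(of_nat (card E) + 1 :: rat)
      = of_nat (card (cycle_partition E \<nu>)) + of_nat (card (cycle_partition E (\<nu> \<circ> \<tau>)))"
    using g0 one by (simp add: genus_def)
  then have count: "card E + 1 = card (cycle_partition E \<nu>) + card (cycle_partition E (\<nu> \<circ> \<tau>))"
    by (metis of_nat_1 of_nat_add of_nat_eq_iff)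
  have "\<nu> \<circ> \<tau> = id"
  proof (rule ccontr)
    assume "\<nu> \<circ> \<tau> \<noteq> id"
    then obtain b where b: "(\<nu> \<circ> \<tau>) b \<noteq> b" by (auto simp: fun_eq_iff)
    define d where "d = (\<nu> \<circ> \<tau>) b"
    have bE: "b \<in> E" using b \<nu>\<tau> unfolding permutes_def by blast
    have dE: "d \<in> E" unfolding d_def using bE \<nu>\<tau> permutes_in_image by metis
    have bd: "b \<noteq> d" using b by (simp add: d_def)
    define \<tau>' where "\<tau>' = \<tau> \<circ> Transposition.transpose b d"
    have \<tau>': "\<tau>' permutes E" unfolding \<tau>'_def using perm_comp_transpose[OF fin \<tau> bE dE] .
    have "orbit \<tau> b = E" using one bE by (auto simp: cycle_partition_def)
    then have "card (cycle_partition E \<tau>') = 2"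
      unfolding \<tau>'_def using card_cycles_split[OF fin \<tau> bE dE] dE bd one by simp
    moreover have "card (cycle_partition E (\<nu> \<circ> \<tau>')) = Suc (card (cycle_partition E (\<nu> \<circ> \<tau>)))"
      unfolding \<tau>'_def comp_assoc[symmetric] using bd
      by (intro card_cycles_split[OF fin \<nu>\<tau> bE dE]) (unfold d_def, rule orbit.base)
    moreover have "partition_join E (cycle_partition E \<tau>') (cycle_partition E \<nu>) = {E}"
      unfolding \<tau>'_def using one bE dE bd by (intro nonsep) auto
    ultimately show False
      using connected_cycles_bound[OF fin \<nu> \<tau>' ne] count by simp
  qed
  then have "\<nu> x = inv \<tau> x" for x
    using permutes_inverses(1)[OF \<tau>, of x] by (metis comp_apply id_apply)
  then show ?thesis by blast
qed

lemma inv_in_NS_single_cycle: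
  assumes fin: "finite E" and \<tau>: "\<tau> permutes E" and one: "cycle_partition E \<tau> = {E}"
  shows "inv \<tau> \<in> NS E \<tau>" and "cycle_partition E (inv \<tau>) = {E}"
proof -
  have ne: "E \<noteq> {}" using one by (auto simp: cycle_partition_def)
  have inv: "inv \<tau> permutes E" using \<tau> by (rule permutes_inv)
  have "orbit (inv \<tau>) x = orbit \<tau> x" for x
    using \<tau> fin by (intro orbit_inv_eq permutes_imp_permutation)
  then show one': "cycle_partition E (inv \<tau>) = {E}" using one by (simp add: cycle_partition_def)
  have "orbit id x = {x}" for x :: 'a using orbit_eq_singleton_iff[of id x] by simp
  then have "card (cycle_partition E id) = card E"
    by (simp add: cycle_partition_def card_image)
  moreover have "inv \<tau> \<circ> \<tau> = id" using permutes_inv_o(2)[OF \<tau>] .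
  moreover have join: "partition_join E (cycle_partition E f) (cycle_partition E (inv \<tau>)) = {E}"
    if "f permutes E" for f
    using ne one' cycle_partition_subset[OF fin that] by (intro partition_join_whole) auto
  ultimately have "genus E (inv \<tau>) \<tau> = 0"
    using one one' join[OF inv] by (simp add: genus_def)
  then show "inv \<tau> \<in> NS E \<tau>"
    using inv join[OF \<tau>] join[OF perm_comp_transpose[OF fin \<tau>]] one by (simp add: NS_def)
qed

lemma NS_single_cycle:
  assumes "finite E" and "\<tau> permutes E" and "cycle_partition E \<tau> = {E}"
  shows "NS E \<tau> = {inv \<tau>}"
  using NS_single_cycle_imp_inv[OF assms] inv_in_NS_single_cycle(1)[OF assms] by blast

lemma finite_pts: "finite G \<Longrightarrow> finite (pts G \<mu>)"
  by (simp add: pts_def)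

lemma gamma_permutes:
  assumes "finite G"
  shows "gamma G \<mu> permutes pts G \<mu>"
proof (rule bij_imp_permutes)
  have maps: "gamma G \<mu> ` pts G \<mu> \<subseteq> pts G \<mu>"
    by (auto simp: gamma_def pts_def intro!: mod_less_divisor gr_zeroI)
  have "inj_on (gamma G \<mu>) (pts G \<mu>)"
  proof (rule inj_onI)
    fix x y assume "x \<in> pts G \<mu>" "y \<in> pts G \<mu>" "gamma G \<mu> x = gamma G \<mu> y"
    then have "fst x = fst y" "Suc (snd x) mod \<mu> (fst x) = Suc (snd y) mod \<mu> (fst x)"
      and lt: "snd x < \<mu> (fst x)" "snd y < \<mu> (fst x)"
      by (auto simp: gamma_def pts_def)
    then show "x = y" using lt by (auto simp: prod_eq_iff mod_Suc split: if_splits)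
  qed
  then show "bij_betw (gamma G \<mu>) (pts G \<mu>) (pts G \<mu>)"
    using maps finite_pts[OF assms] by (simp add: bij_betw_def endo_inj_surj)
qed (simp add: gamma_def)

lemma gamma_singleton_cycle:
  assumes "\<mu> i > 0"
  shows "cycle_partition (pts {i} \<mu>) (gamma {i} \<mu>) = {pts {i} \<mu>}"
proof -
  let ?E = "pts {i} \<mu>" and ?g = "gamma {i} \<mu>"
  have fin: "finite ?E" and g: "?g permutes ?E" by (simp_all add: finite_pts gamma_permutes)
  have "(i, a) \<in> orbit ?g (i, 0)" if "a < \<mu> i" for a
    using that
  proof (induction a)
    case 0
    show ?case using perm_self_in_orbit[OF fin g] .
  next
    case (Suc a)
    then have "?g (i, a) \<in> orbit ?g (i, 0)" by (intro orbit.step) simp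
    moreover have "?g (i, a) = (i, Suc a)" using Suc.prems by (simp add: gamma_def pts_def)
    ultimately show ?case by (simp only:)
  qed
  then have "?E \<subseteq> orbit ?g (i, 0)" by (auto simp: pts_def)
  moreover have "orbit ?g (i, 0) \<subseteq> ?E"
    using assms by (intro permutes_orbit_subset[OF g]) (simp add: pts_def)
  ultimately have "orbit ?g (i, 0) = ?E" by auto
  then have "orbit ?g x = ?E" if "x \<in> ?E" for x
    using perm_orbit_eq[OF fin g] that by metis
  moreover have "?E \<noteq> {}" using assms by (auto simp: pts_def)
  ultimately show ?thesis by (auto simp: cycle_partition_def)
qed

text \<open>This is what makes \<open>C\<^sub>1\<close> the right convention for a singleton block: the only hypermap over one
  cycle of length \<open>\<mu>\<close> has a single cycle, of weight \<open>\<kappa>\<^sub>\<mu>\<close>.\<close>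

lemma NSmu_singleton:
  assumes "\<mu> i > 0"
  shows "NSmu {i} \<mu> = {inv (gamma {i} \<mu>)}"
    and "cycle_partition (pts {i} \<mu>) (inv (gamma {i} \<mu>)) = {pts {i} \<mu>}"
  unfolding NSmu_def
  using NS_single_cycle inv_in_NS_single_cycle(2) gamma_permutes gamma_singleton_cycle[of \<mu> i] assms
    finite_pts by (metis finite.emptyI finite.insertI)+

lemma finite_NSmu:
  assumes "finite G"
  shows "finite (NSmu G \<mu>)"
  using finite_permutations[OF finite_pts[OF assms]]
  by (rule finite_subset[rotated]) (auto simp: NSmu_def NS_def)

section \<open>Derivatives of polynomials in the cumulants\<close>

lemma dkappa_superset:
  assumes "finite A" and "Poly_Mapping.keys p \<subseteq> A"
  shows "dkappa j p = (\<Sum>m\<in>A. Poly_Mapping.single (m - Poly_Mapping.single {#j#} 1)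
       (of_nat (Poly_Mapping.lookup m {#j#}) * Poly_Mapping.lookup p m))"
  unfolding dkappa_def using assms
  by (intro sum.mono_neutral_left) (auto simp: in_keys_iff)

lemma dkappa_zero [simp]: "dkappa j 0 = 0"
  by (simp add: dkappa_def)

lemma dkappa_add: "dkappa j (p + q) = dkappa j p + dkappa j q"
proof -
  let ?A = "Poly_Mapping.keys p \<union> Poly_Mapping.keys q"
  have "dkappa j r = (\<Sum>m\<in>?A. Poly_Mapping.single (m - Poly_Mapping.single {#j#} 1)
       (of_nat (Poly_Mapping.lookup m {#j#}) * Poly_Mapping.lookup r m))"
    if "Poly_Mapping.keys r \<subseteq> ?A" for r :: "'a kpoly"
    using that by (intro dkappa_superset) auto
  from this[of p] this[of q] this[of "p + q"] show ?thesis
    using Poly_Mapping.keys_add[of p q]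
    by (simp add: lookup_add distrib_left single_add sum.distrib)
qed

lemma dkappa_sum: "dkappa j (sum f A) = (\<Sum>x\<in>A. dkappa j (f x))"
  by (induct A rule: infinite_finite_induct) (simp_all add: dkappa_add)

lemma dkappa_single:
  "dkappa j (Poly_Mapping.single m c) =
     Poly_Mapping.single (m - Poly_Mapping.single {#j#} 1) (of_nat (Poly_Mapping.lookup m {#j#}) * c)"
  by (subst dkappa_superset[of "{m}"]) auto

lemma poly_mapping_sum_single:
  "(\<Sum>m\<in>Poly_Mapping.keys p. Poly_Mapping.single m (Poly_Mapping.lookup p m)) = p"
  by (rule poly_mapping_eqI) (simp add: lookup_sum lookup_single when_def in_keys_iff)

text \<open>Identities between additive operations on polynomials are checked on monomials.\<close>

lemma kpoly_linear_eqI: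
  fixes F G :: "'r::comm_ring_1 kpoly \<Rightarrow> 'r kpoly"
  assumes "\<And>(A :: (nat multiset \<Rightarrow>\<^sub>0 nat) set) f. F (sum f A) = (\<Sum>x\<in>A. F (f x))"
    and "\<And>(A :: (nat multiset \<Rightarrow>\<^sub>0 nat) set) f. G (sum f A) = (\<Sum>x\<in>A. G (f x))"
    and "\<And>m c. F (Poly_Mapping.single m c) = G (Poly_Mapping.single m c)"
  shows "F p = G p"
  by (subst (1 2) poly_mapping_sum_single[symmetric, of p]) (simp only: assms)

lemma lookup_minus_single:
  "Poly_Mapping.lookup (m - Poly_Mapping.single a (Suc 0)) b = Poly_Mapping.lookup m b - (if a = b then 1 else 0)"
  by (simp add: lookup_minus lookup_single when_def)

lemma dkappa_commute: "dkappa i (dkappa j p) = dkappa j (dkappa i p)"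
proof (rule kpoly_linear_eqI[of "\<lambda>p. dkappa i (dkappa j p)" "\<lambda>p. dkappa j (dkappa i p)"])
  fix m :: "nat multiset \<Rightarrow>\<^sub>0 nat" and c :: 'a
  have "m - Poly_Mapping.single {#j#} 1 - Poly_Mapping.single {#i#} 1
      = m - Poly_Mapping.single {#i#} 1 - Poly_Mapping.single {#j#} (1::nat)"
    by (rule poly_mapping_eqI) (simp add: lookup_minus_single)
  then show "dkappa i (dkappa j (Poly_Mapping.single m c)) = dkappa j (dkappa i (Poly_Mapping.single m c))"
    by (cases "i = j") (simp_all add: dkappa_single lookup_minus_single mult_ac)
qed (simp_all add: dkappa_sum)

text \<open>Products of cumulants are derived factor by factor; this Leibniz rule is one such step.\<close>

lemma dkappa_kappa_mult:
  "dkappa j (kappa M * p) = (if M = {#j#} then p else 0) + kappa M * dkappa j p"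
proof (rule kpoly_linear_eqI[of "\<lambda>p. dkappa j (kappa M * p)"
      "\<lambda>p. (if M = {#j#} then p else 0) + kappa M * dkappa j p"])
  fix m :: "nat multiset \<Rightarrow>\<^sub>0 nat" and c :: 'a
  let ?e = "Poly_Mapping.single M (1::nat)" and ?d = "Poly_Mapping.single {#j#} (1::nat)"
  show "dkappa j (kappa M * Poly_Mapping.single m c) =
      (if M = {#j#} then Poly_Mapping.single m c else 0) + kappa M * dkappa j (Poly_Mapping.single m c)"
  proof (cases "Poly_Mapping.lookup m {#j#} = 0")
    case True
    then show ?thesis
      by (simp add: kappa_def mult_single dkappa_single lookup_add lookup_single when_def)
  next
    case False
    \<comment> \<open>Exponents are subtracted with truncation, so this relies on \<open>\<kappa>\<^sub>j\<close> dividing the monomial.\<close>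
    then have "?e + (m - ?d) = ?e + m - ?d"
      by (intro poly_mapping_eqI) (auto simp: lookup_minus lookup_add lookup_single when_def)
    then show ?thesis
      by (simp add: kappa_def mult_single dkappa_single lookup_add lookup_single when_def
          distrib_right single_add)
  qed
qed (simp_all add: dkappa_sum sum_distrib_left sum.distrib)

lemma dkappa_prod_kappa:
  assumes "finite P"
  shows "dkappa j (\<Prod>V\<in>P. kappa {#g V#}) =
    ((\<Sum>V | V \<in> P \<and> g V = j. \<Prod>W\<in>P - {V}. kappa {#g W#}) :: 'r::comm_ring_1 kpoly)"
  using assms
proof induction
  case empty
  show ?case by (simp add: dkappa_single flip: single_one)
next
  case (insert U P)
  have rest: "(\<Prod>W\<in>insert U P - {V}. kappa {#g W#} :: 'r kpoly) = kappa {#g U#} * (\<Prod>W\<in>P - {V}. kappa {#g W#})"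
    if "V \<in> P" for V
  proof -
    have "insert U P - {V} = insert U (P - {V})" using insert that by auto
    then show ?thesis using insert by simp
  qed
  have "dkappa j (\<Prod>V\<in>insert U P. kappa {#g V#}) = (if g U = j then \<Prod>V\<in>P. kappa {#g V#} else 0) +
      (\<Sum>V | V \<in> P \<and> g V = j. \<Prod>W\<in>insert U P - {V}. kappa {#g W#} :: 'r kpoly)"
    using insert by (simp add: dkappa_kappa_mult rest sum_distrib_left)
  also have "\<dots> = (\<Sum>V | V \<in> insert U P \<and> g V = j. \<Prod>W\<in>insert U P - {V}. kappa {#g W#})"
  proof (cases "g U = j")
    case True
    then have "{V. V \<in> insert U P \<and> g V = j} = insert U {V. V \<in> P \<and> g V = j}" by auto
    then show ?thesis using True insert by simp
  next
    case False
    then have "{V. V \<in> insert U P \<and> g V = j} = {V. V \<in> P \<and> g V = j}" by auto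
    then show ?thesis using False by simp
  qed
  finally show ?case .
qed

section \<open>Iterated derivatives and marked cycles\<close>

lemma series_dkappas_empty [simp]: "series_dkappas {} j f = f"
  by (simp add: series_dkappas_def)

lemma series_dkappas_insert:
  assumes "finite S" and "K \<notin> S"
  shows "series_dkappas (insert K S) j f = series_dkappa (j K) (series_dkappas S j f)"
proof -
  interpret comp_fun_commute "\<lambda>K. series_dkappa (j K) :: 'b kseries \<Rightarrow> 'b kseries"
    by standard (auto simp: series_dkappa_def fun_eq_iff dkappa_commute)
  show ?thesis using assms by (simp add: series_dkappas_def)
qed

text \<open>These index the terms of an iterated derivative of \<open>\<Prod>V\<in>P. \<kappa>\<^bsub>g V\<^esub>\<close>: the derivative with respect
  to \<open>\<kappa>\<^bsub>j K\<^esub>\<close> removes the factor of \<open>l K\<close>.\<close>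

definition marked_maps :: "'k set \<Rightarrow> 'v set \<Rightarrow> ('v \<Rightarrow> nat) \<Rightarrow> ('k \<Rightarrow> nat) \<Rightarrow> ('k \<Rightarrow> 'v) set" where
  "marked_maps S P g j = {l \<in> S \<rightarrow>\<^sub>E P. inj_on l S \<and> (\<forall>K\<in>S. g (l K) = j K)}"

lemma finite_marked_maps: "finite S \<Longrightarrow> finite P \<Longrightarrow> finite (marked_maps S P g j)"
  unfolding marked_maps_def by (rule finite_subset[of _ "S \<rightarrow>\<^sub>E P"]) (auto intro: finite_PiE)

text \<open>Extending an injective map by a value for \<open>K\<close> amounts to choosing that value outside its image.\<close>

lemma sum_marked_maps_insert:
  assumes "finite S" "finite P" "K \<notin> S"
  shows "(\<Sum>l\<in>marked_maps S P g j. \<Sum>V | V \<in> P - l ` S \<and> g V = j K. F (P - l ` S - {V})) =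
    (\<Sum>l\<in>marked_maps (insert K S) P g j. F (P - l ` insert K S))"
proof -
  let ?M = "marked_maps S P g j" and ?V = "\<lambda>l. {V. V \<in> P - l ` S \<and> g V = j K}"
  have "(\<Sum>l\<in>?M. \<Sum>V\<in>?V l. F (P - l ` S - {V})) =
      (\<Sum>(l, V)\<in>Sigma ?M ?V. F (P - l ` S - {V}))"
    using assms by (intro sum.Sigma) (auto simp: finite_marked_maps)
  also have "\<dots> = (\<Sum>l\<in>marked_maps (insert K S) P g j. F (P - l ` insert K S))"
  proof (rule sum.reindex_bij_witness[where i = "\<lambda>l. (l(K := undefined), l K)" and j = "\<lambda>(l, V). l(K := V)"])
    fix x assume "x \<in> Sigma ?M ?V"
    then obtain l V where x: "x = (l, V)" and l: "l \<in> S \<rightarrow>\<^sub>E P" "inj_on l S" "\<And>K. K \<in> S \<Longrightarrow> g (l K) = j K"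
      and V: "V \<in> P" "V \<notin> l ` S" "g V = j K"
      by (auto simp: marked_maps_def)
    have lK: "l K = undefined" using l(1) \<open>K \<notin> S\<close> by (auto simp: PiE_def extensional_def)
    have im: "l(K := V) ` S = l ` S" using \<open>K \<notin> S\<close> by auto
    show "(((case x of (l, V) \<Rightarrow> l(K := V))(K := undefined)), (case x of (l, V) \<Rightarrow> l(K := V)) K) = x"
      using lK by (auto simp: x)
    have "l(K := V) \<in> insert K S \<rightarrow>\<^sub>E P" using l(1) V(1) by (auto simp: PiE_def extensional_def)
    moreover have "inj_on (l(K := V)) (insert K S)"
      using l(2) V(2) \<open>K \<notin> S\<close> im by (auto simp: inj_on_def)
    moreover have "\<forall>K'\<in>insert K S. g ((l(K := V)) K') = j K'" using l(3) V(3) by auto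
    ultimately show "(case x of (l, V) \<Rightarrow> l(K := V)) \<in> marked_maps (insert K S) P g j"
      by (simp add: x marked_maps_def)
    have "P - l(K := V) ` insert K S = P - l ` S - {V}" using im by auto
    then show "F (P - (case x of (l, V) \<Rightarrow> l(K := V)) ` insert K S) = (case x of (l, V) \<Rightarrow> F (P - l ` S - {V}))"
      by (simp add: x)
  next
    fix l assume "l \<in> marked_maps (insert K S) P g j"
    then have l: "l \<in> insert K S \<rightarrow>\<^sub>E P" "inj_on l (insert K S)" "\<And>K'. K' \<in> insert K S \<Longrightarrow> g (l K') = j K'"
      by (auto simp: marked_maps_def)
    have im: "l(K := undefined) ` S = l ` S" using \<open>K \<notin> S\<close> by auto
    have "l(K := undefined) \<in> S \<rightarrow>\<^sub>E P" using l(1) \<open>K \<notin> S\<close> by (auto simp: PiE_def extensional_def)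
    moreover have "inj_on (l(K := undefined)) S" using l(2) \<open>K \<notin> S\<close> by (auto simp: inj_on_def)
    moreover have "\<forall>K'\<in>S. g ((l(K := undefined)) K') = j K'" using l(3) \<open>K \<notin> S\<close> by auto
    moreover have "l K \<in> P" "l K \<notin> l ` S" "g (l K) = j K" using l \<open>K \<notin> S\<close> by (auto simp: inj_on_def)
    ultimately have "l(K := undefined) \<in> ?M" "l K \<in> ?V (l(K := undefined))"
      unfolding marked_maps_def im by blast+
    then show "(l(K := undefined), l K) \<in> Sigma ?M ?V" by (intro SigmaI)
  qed auto
  finally show ?thesis .
qed

text \<open>Each derivative removes one factor from the product, and factors removed by different \<open>K\<close> are
  different.  A term of the iterated derivative thus records which factor each \<open>K\<close> removed: this
  is an injective map, and the surviving factors are those outside its image.\<close>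

lemma series_dkappas_sum_prod_kappa:
  assumes S: "finite S" and P: "\<And>x. x \<in> X \<Longrightarrow> finite (P x)"
    and f: "f m = (\<Sum>x\<in>X. \<Prod>V\<in>P x. kappa {#g V#})"
  shows "series_dkappas S j f m =
    (\<Sum>x\<in>X. \<Sum>l\<in>marked_maps S (P x) g j. \<Prod>V\<in>P x - l ` S. kappa {#g V#})"
  using S
proof induction
  case empty
  show ?case by (simp add: f marked_maps_def)
next
  case (insert K S)
  have "series_dkappas (insert K S) j f m =
      (\<Sum>x\<in>X. \<Sum>l\<in>marked_maps S (P x) g j. dkappa (j K) (\<Prod>V\<in>P x - l ` S. kappa {#g V#}))"
    using insert by (simp add: series_dkappas_insert series_dkappa_def dkappa_sum)
  also have "\<dots> = (\<Sum>x\<in>X. \<Sum>l\<in>marked_maps S (P x) g j.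
      \<Sum>V | V \<in> P x - l ` S \<and> g V = j K. \<Prod>W\<in>P x - l ` S - {V}. kappa {#g W#})"
    using P by (intro sum.cong refl dkappa_prod_kappa) simp
  also have "\<dots> = (\<Sum>x\<in>X. \<Sum>l\<in>marked_maps (insert K S) (P x) g j. \<Prod>V\<in>P x - l ` insert K S. kappa {#g V#})"
    using insert P by (intro sum.cong refl sum_marked_maps_insert)
  finally show ?case .
qed

section \<open>Products of series in disjoint sets of variables\<close>

definition monomial_part :: "'a set \<Rightarrow> ('a \<Rightarrow>\<^sub>0 nat) \<Rightarrow> ('a \<Rightarrow>\<^sub>0 nat)" where
  "monomial_part G m = Poly_Mapping.mapp (\<lambda>i e. if i \<in> G then e else 0) m"

lemma lookup_monomial_part:
  "Poly_Mapping.lookup (monomial_part G m) i = (if i \<in> G then Poly_Mapping.lookup m i else 0)"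
  by (auto simp: monomial_part_def lookup_mapp when_def in_keys_iff)

lemma keys_monomial_part: "Poly_Mapping.keys (monomial_part G m) = Poly_Mapping.keys m \<inter> G"
  by (auto simp: in_keys_iff lookup_monomial_part split: if_splits)

text \<open>A sum over an infinite set is 0 by convention, so evaluating a Cauchy product starts with the
  finiteness of the set of decompositions of a monomial.\<close>

lemma finite_monomial_divisors:
  "finite {q :: 'a \<Rightarrow>\<^sub>0 nat. \<forall>i. Poly_Mapping.lookup q i \<le> Poly_Mapping.lookup m i}" (is "finite ?D")
proof -
  let ?r = "\<lambda>q. restrict (Poly_Mapping.lookup q) (Poly_Mapping.keys m)"
  have "finite (?r ` ?D)"
    by (rule finite_subset[of _ "PiE (Poly_Mapping.keys m) (\<lambda>i. {..Poly_Mapping.lookup m i})"])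
      (auto intro: finite_PiE)
  moreover have "inj_on ?r ?D"
  proof (rule inj_onI, rule poly_mapping_eqI)
    fix q q' i assume q: "q \<in> ?D" "q' \<in> ?D" "?r q = ?r q'"
    show "Poly_Mapping.lookup q i = Poly_Mapping.lookup q' i"
    proof (cases "i \<in> Poly_Mapping.keys m")
      case True
      then show ?thesis using fun_cong[OF q(3), of i] by simp
    next
      case False
      then have "Poly_Mapping.lookup m i = 0" by (simp add: in_keys_iff)
      then show ?thesis using q(1,2) by (metis (mono_tags) le_zero_eq mem_Collect_eq)
    qed
  qed
  ultimately show ?thesis by (rule finite_imageD)
qed

text \<open>At most one decomposition of \<open>m\<close> contributes to the Cauchy product: since the supports of the
  factors are prescribed and disjoint, it must cut \<open>m\<close> along the sets \<open>G\<close>.\<close>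

lemma series_prod_disjoint_supports:
  fixes f :: "nat set \<Rightarrow> 'r::comm_ring_1 kseries"
  assumes fin: "finite \<pi>" and disj: "disjoint \<pi>"
    and supp: "\<And>G m. G \<in> \<pi> \<Longrightarrow> f G m \<noteq> 0 \<Longrightarrow> Poly_Mapping.keys m = G"
  shows "series_prod \<pi> f m =
    (if Poly_Mapping.keys m = \<Union>\<pi> then \<Prod>G\<in>\<pi>. f G (monomial_part G m) else 0)"
proof -
  define D where "D = {d. d \<in> \<pi> \<rightarrow>\<^sub>E UNIV \<and> (\<Sum>G\<in>\<pi>. d G) = m}"
  let ?d = "\<lambda>G\<in>\<pi>. monomial_part G m"
  have lookup_m: "Poly_Mapping.lookup m i = (\<Sum>G\<in>\<pi>. Poly_Mapping.lookup (d G) i)" if "d \<in> D" for d i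
    using that by (auto simp: D_def lookup_sum)
  have "D \<subseteq> PiE \<pi> (\<lambda>_. {q. \<forall>i. Poly_Mapping.lookup q i \<le> Poly_Mapping.lookup m i})"
  proof
    fix d assume d: "d \<in> D"
    have "Poly_Mapping.lookup (d G) i \<le> Poly_Mapping.lookup m i" if "G \<in> \<pi>" for G i
      unfolding lookup_m[OF d] using fin that by (intro member_le_sum) auto
    then show "d \<in> PiE \<pi> (\<lambda>_. {q. \<forall>i. Poly_Mapping.lookup q i \<le> Poly_Mapping.lookup m i})"
      using d by (auto simp: D_def PiE_def)
  qed
  then have finD: "finite D"
    by (rule finite_subset) (intro finite_PiE fin finite_monomial_divisors)
  have only: "d = ?d \<and> Poly_Mapping.keys m = \<Union>\<pi>" if d: "d \<in> D" and nz: "(\<Prod>G\<in>\<pi>. f G (d G)) \<noteq> 0" for d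
  proof -
    have keys: "Poly_Mapping.keys (d G) = G" if "G \<in> \<pi>" for G
      using nz fin that supp by (metis prod_zero)
    have at: "Poly_Mapping.lookup m i = Poly_Mapping.lookup (d G) i" if G: "G \<in> \<pi>" "i \<in> G" for G i
    proof -
      have "Poly_Mapping.lookup (d G') i = 0" if "G' \<in> \<pi> - {G}" for G'
      proof -
        have "i \<notin> G'" using disj G that by (auto simp: disjoint_def)
        then show ?thesis using keys[of G'] that by (metis DiffD1 in_keys_iff)
      qed
      then show ?thesis
        unfolding lookup_m[OF d] using fin G by (subst sum.remove[of _ G]) auto
    qed
    have "Poly_Mapping.keys m = \<Union>\<pi>"
    proof
      show "Poly_Mapping.keys m \<subseteq> \<Union>\<pi>"
      proof
        fix i assume "i \<in> Poly_Mapping.keys m"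
        then have "(\<Sum>G\<in>\<pi>. Poly_Mapping.lookup (d G) i) \<noteq> 0" using lookup_m[OF d] by (simp add: in_keys_iff)
        then obtain G where "G \<in> \<pi>" "Poly_Mapping.lookup (d G) i \<noteq> 0" by (meson sum.neutral)
        then show "i \<in> \<Union>\<pi>" using keys[of G] by (auto simp: in_keys_iff)
      qed
      show "\<Union>\<pi> \<subseteq> Poly_Mapping.keys m"
      proof clarify
        fix i G assume G: "G \<in> \<pi>" "i \<in> G"
        then have "i \<in> Poly_Mapping.keys (d G)" using keys by simp
        then show "i \<in> Poly_Mapping.keys m" using at[OF G] by (simp add: in_keys_iff)
      qed
    qed
    moreover have "d = ?d"
    proof (rule PiE_ext[of d \<pi> "\<lambda>_. UNIV" ?d])
      show "d \<in> \<pi> \<rightarrow>\<^sub>E UNIV" using d by (simp add: D_def)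
      show "?d \<in> \<pi> \<rightarrow>\<^sub>E UNIV" by auto
      fix G assume G: "G \<in> \<pi>"
      have "d G = monomial_part G m"
        using at[OF G] keys[OF G]
        by (intro poly_mapping_eqI) (auto simp: lookup_monomial_part in_keys_iff)
      then show "d G = ?d G" using G by simp
    qed
    ultimately show ?thesis by blast
  qed
  have series_prod_eq: "series_prod \<pi> f m = (\<Sum>d\<in>D. \<Prod>G\<in>\<pi>. f G (d G))"
    by (simp add: series_prod_def D_def)
  show ?thesis
  proof (cases "Poly_Mapping.keys m = \<Union>\<pi>")
    case True
    have "(\<Sum>G\<in>\<pi>. monomial_part G m) = m"
    proof (rule poly_mapping_eqI)
      fix i
      show "Poly_Mapping.lookup (\<Sum>G\<in>\<pi>. monomial_part G m) i = Poly_Mapping.lookup m i"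
      proof (cases "i \<in> \<Union>\<pi>")
        case True
        then obtain G where G: "G \<in> \<pi>" "i \<in> G" by auto
        have "i \<notin> G'" if "G' \<in> \<pi> - {G}" for G' using disj G that by (auto simp: disjoint_def)
        then show ?thesis
          unfolding lookup_sum using fin G by (simp add: lookup_monomial_part sum.remove[of _ G])
      next
        case False
        then have "Poly_Mapping.lookup m i = 0" using True by (metis in_keys_iff)
        then show ?thesis by (auto simp: lookup_sum lookup_monomial_part intro: sum.neutral)
      qed
    qed
    then have "?d \<in> D" by (simp add: D_def)
    then have "series_prod \<pi> f m = (\<Sum>d\<in>{?d}. \<Prod>G\<in>\<pi>. f G (d G))"
      unfolding series_prod_eq using finD only by (intro sum.mono_neutral_right) auto
    then show ?thesis using True by simp
  next
    case False
    then have "(\<Prod>G\<in>\<pi>. f G (d G)) = 0" if "d \<in> D" for d using only[OF that] by blast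
    then show ?thesis using False by (simp add: series_prod_eq)
  qed
qed

text \<open>A finite sum regrouped by a labelling of its index set, in a form that produces formal
  summability: only labels that are attained contribute.\<close>

lemma sum_fibers:
  fixes F :: "'j \<Rightarrow> 'r::comm_monoid_add"
  assumes fin: "finite W" and lab: "label ` W \<subseteq> J"
    and F: "\<And>j. j \<in> J \<Longrightarrow> F j = (\<Sum>w | w \<in> W \<and> label w = j. t w)"
  shows "finite {j \<in> J. F j \<noteq> 0}" and "(\<Sum>j | j \<in> J \<and> F j \<noteq> 0. F j) = sum t W"
proof -
  have sub: "{j \<in> J. F j \<noteq> 0} \<subseteq> label ` W"
  proof clarify
    fix j assume j: "j \<in> J" "F j \<noteq> 0"
    then have "{w \<in> W. label w = j} \<noteq> {}" using F by (metis sum.empty)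
    then show "j \<in> label ` W" by auto
  qed
  then show "finite {j \<in> J. F j \<noteq> 0}" using fin finite_subset by blast
  have "(\<Sum>j | j \<in> J \<and> F j \<noteq> 0. F j) = (\<Sum>j\<in>label ` W. F j)"
    using sub fin lab by (intro sum.mono_neutral_left) auto
  also have "\<dots> = (\<Sum>j\<in>label ` W. \<Sum>w | w \<in> W \<and> label w = j. t w)"
    using lab F by (intro sum.cong) auto
  also have "\<dots> = sum t W" using fin by (intro sum.group) auto
  finally show "(\<Sum>j | j \<in> J \<and> F j \<noteq> 0. F j) = sum t W" .
qed

section \<open>Derivatives of the series of a white vertex\<close>

lemma pts_monomial_part:
  "pts G (Poly_Mapping.lookup (monomial_part G m)) = pts G (Poly_Mapping.lookup m)"
  by (auto simp: pts_def lookup_monomial_part)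

lemma NSmu_monomial_part:
  "NSmu G (Poly_Mapping.lookup (monomial_part G m)) = NSmu G (Poly_Mapping.lookup m)"
proof -
  have "gamma G (Poly_Mapping.lookup (monomial_part G m)) = gamma G (Poly_Mapping.lookup m)"
    by (auto simp: gamma_def fun_eq_iff pts_monomial_part) (auto simp: pts_def lookup_monomial_part)
  then show ?thesis by (simp add: NSmu_def pts_monomial_part)
qed

text \<open>On monomials of support exactly \<open>G\<close>, the cases \<open>|G| = 1\<close> and \<open>|G| \<ge> 2\<close> of the
  definition agree, by the classification of hypermaps over one cycle.\<close>

lemma Ctilde_full_support:
  assumes "Poly_Mapping.keys m = G"
  shows "Ctilde G m = (\<Sum>\<nu>\<in>NSmu G (Poly_Mapping.lookup m).
    \<Prod>V\<in>cycle_partition (pts G (Poly_Mapping.lookup m)) \<nu>. kappa {#card V#})"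
proof (cases "card G = 1")
  case True
  then obtain i where G: "G = {i}" by (auto simp: card_1_singleton_iff)
  then have pos: "Poly_Mapping.lookup m i > 0" using assms by (metis gr0I in_keys_iff insertI1)
  have "card (pts {i} \<mu>) = \<mu> i" for \<mu> by (simp add: pts_def)
  then show ?thesis
    using assms pos NSmu_singleton[of "Poly_Mapping.lookup m" i, OF pos] by (auto simp: Ctilde_def C1_def G)
next
  case False
  then show ?thesis using assms by (simp add: Ctilde_def series_pos_def)
qed

text \<open>The derivative of a constant vanishes.  The coefficients 0 and 1 are treated as an empty sum and
  an empty product, into which no nonempty set of marks can be mapped.\<close>

lemma series_dkappas_const:
  assumes S: "finite S" and f: "f m = 0 \<or> (f m = 1 \<and> S \<noteq> {})"
  shows "series_dkappas S j f m = 0"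
  using f
proof
  assume "f m = 0"
  then show ?thesis
    using series_dkappas_sum_prod_kappa[OF S, of "{} :: unit set" "\<lambda>_. {} :: unit set" f m "\<lambda>_. 0"] by simp
next
  assume one: "f m = 1 \<and> S \<noteq> {}"
  then have "marked_maps S ({} :: unit set) (\<lambda>_. 0) j = {}" by (auto simp: marked_maps_def)
  then show ?thesis
    using one series_dkappas_sum_prod_kappa[OF S, of "UNIV :: unit set" "\<lambda>_. {} :: unit set" f m "\<lambda>_. 0"]
    by simp
qed

text \<open>For a singleton \<open>G\<close> the constant term 1 of \<open>C\<^sub>1\<close> would violate the support condition; it is
  killed as soon as one derivative is taken.\<close>

lemma series_dkappas_Ctilde:
  assumes G: "finite G" and S: "finite S" and marked: "S \<noteq> {} \<or> card G \<noteq> 1"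
  shows "series_dkappas S j (Ctilde G :: 'r::comm_ring_1 kseries) m =
    (if Poly_Mapping.keys m = G then
       \<Sum>\<nu>\<in>NSmu G (Poly_Mapping.lookup m).
       \<Sum>l\<in>marked_maps S (cycle_partition (pts G (Poly_Mapping.lookup m)) \<nu>) card j.
       \<Prod>V\<in>cycle_partition (pts G (Poly_Mapping.lookup m)) \<nu> - l ` S. kappa {#card V#}
     else 0)"
proof (cases "Poly_Mapping.keys m = G")
  case True
  have "finite (cycle_partition (pts G \<mu>) \<nu>)" for \<mu> \<nu>
    using finite_pts[OF G] by (simp add: cycle_partition_def)
  then show ?thesis
    using True by (simp add: series_dkappas_sum_prod_kappa[OF S _ Ctilde_full_support])
next
  case False
  have "Ctilde G m = (0 :: 'r kpoly) \<or> (Ctilde G m = (1 :: 'r kpoly) \<and> S \<noteq> {})"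
  proof (cases "card G = 1")
    case True
    then obtain i where "G = {i}" by (auto simp: card_1_singleton_iff)
    then show ?thesis using False marked by (auto simp: Ctilde_def C1_def)
  next
    case card: False
    then show ?thesis using False by (simp add: Ctilde_def series_pos_def)
  qed
  then show ?thesis using False series_dkappas_const[OF S] by simp
qed

section \<open>The product formula\<close>

lemma blue_at_nonempty:
  assumes T: "T \<in> bip_trees \<pi>" and G: "G \<in> \<pi>" "G' \<in> \<pi>" "G \<noteq> G'"
  shows "blue_at T G \<noteq> {}"
proof -
  have "(Inl G, Inl G') \<in> (bip_adj \<pi> T)\<^sup>*"
    using T G by (auto simp: bip_trees_def tree_graph_def connected_graph_def bip_verts_def)
  then obtain v where "(Inl G, v) \<in> bip_adj \<pi> T"
    using G(3) by (metis Inl_inject converse_rtranclE)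
  then show ?thesis by (auto simp: bip_adj_def blue_at_def)
qed

text \<open>A block that is not the only one has a neighbour, as the tree is connected; a block that is the
  only one has at least two elements, as the partition is not the one into singletons.\<close>

lemma blue_at_nonempty_or_card:
  assumes \<pi>: "\<pi> \<in> nontrivial_partitions I" and T: "T \<in> bip_trees \<pi>" and G: "G \<in> \<pi>"
  shows "blue_at T G \<noteq> {} \<or> card G \<noteq> 1"
proof (cases "\<pi> = {G}")
  case True
  have part: "partition_on I \<pi>" "\<pi> \<noteq> (\<lambda>i. {i}) ` I" using \<pi> by (auto simp: nontrivial_partitions_def)
  then have "I = G" using True by (auto simp: partition_on_def)
  then show ?thesis using part True by (auto simp: card_1_singleton_iff)
next
  case False
  then obtain G' where "G' \<in> \<pi>" "G \<noteq> G'" using G by auto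
  then show ?thesis using blue_at_nonempty[OF T G] by blast
qed

theorem proposition5p3:
  fixes p :: nat and I :: "nat set" and \<pi> :: "nat set set" and T :: "nat set set set"
  assumes "I \<subseteq> {1..p}"
    and "\<pi> \<in> nontrivial_partitions I"
    and "T \<in> bip_trees \<pi>"
  shows "has_formal_sum
    (\<lambda>j. series_scale (\<Prod>K\<in>T. kappa (image_mset (\<lambda>G. j (K, G)) (mset_set K)))
       (series_prod \<pi> (\<lambda>G. series_dkappas (blue_at T G) (\<lambda>K. j (K, G)) (Ctilde G))))
    (edge_labels T)
    (Cbar I \<pi> T :: 'r::comm_ring_1 kseries)"
proof -
  have finI: "finite I" using assms(1) finite_subset by blast
  have part: "partition_on I \<pi>" using assms(2) by (simp add: nontrivial_partitions_def)
  have Un: "\<Union>\<pi> = I" and disj: "disjoint \<pi>" using part by (auto simp: partition_on_def)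
  have fin\<pi>: "finite \<pi>" using finI Un by (metis finite_UnionD)
  have finG: "finite G" if "G \<in> \<pi>" for G using that Un finI by (metis Union_upper finite_subset)
  have T\<pi>: "K \<subseteq> \<pi>" if "K \<in> T" for K using assms(3) that by (auto simp: bip_trees_def)
  have finT: "finite T" using T\<pi> fin\<pi> by (meson PowI finite_Pow_iff finite_subset subsetI)
  have finK: "finite K" if "K \<in> T" for K using T\<pi>[OF that] fin\<pi> finite_subset by blast
  have finS: "finite (blue_at T G)" for G using finT by (simp add: blue_at_def)
  let ?A = "\<lambda>j G. series_dkappas (blue_at T G) (\<lambda>K. j (K, G)) (Ctilde G) :: 'r kseries"
  let ?F = "\<lambda>j. series_scale (\<Prod>K\<in>T. kappa (image_mset (\<lambda>G. j (K, G)) (mset_set K)))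
       (series_prod \<pi> (?A j))"
  note A = series_dkappas_Ctilde[OF finG finS blue_at_nonempty_or_card[OF assms(2,3)]]
  have prod_A: "series_prod \<pi> (?A j) m =
      (if Poly_Mapping.keys m = I then \<Prod>G\<in>\<pi>. ?A j G (monomial_part G m) else 0)" for j m
    unfolding Un[symmetric]
    by (rule series_prod_disjoint_supports[OF fin\<pi> disj]) (simp add: A split: if_splits)
  have "finite {j \<in> edge_labels T. ?F j m \<noteq> 0} \<and>
      (\<Sum>j | j \<in> edge_labels T \<and> ?F j m \<noteq> 0. ?F j m) = Cbar I \<pi> T m" for m
  proof (cases "Poly_Mapping.keys m = I")
    case False
    then have "?F j m = 0" for j by (simp add: prod_A series_scale_def)
    then show ?thesis using False by (simp add: Cbar_def series_pos_def)
  next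
    case True
    \<comment> \<open>\<open>w = (\<nu>, L)\<close> with \<open>\<nu> \<in> N\<close> and \<open>L \<in> M \<nu>\<close> indexes the terms of the left-hand side, and
      \<open>lab w\<close> is the only family \<open>j\<close> on the right-hand side to which \<open>w\<close> contributes.\<close>
    define cyc where "cyc G \<nu> = cycle_partition (pts G (Poly_Mapping.lookup m)) \<nu>" for G \<nu>
    define N where "N = (\<Pi>\<^sub>E G\<in>\<pi>. NSmu G (Poly_Mapping.lookup m))"
    define M where "M \<nu> = (\<Pi>\<^sub>E G\<in>\<pi>. {l \<in> blue_at T G \<rightarrow>\<^sub>E cyc G (\<nu> G). inj_on l (blue_at T G)})" for \<nu>
    define rest where "rest \<nu> L = (\<Prod>G\<in>\<pi>. \<Prod>V\<in>cyc G (\<nu> G) - L G ` blue_at T G. kappa {#card V#} :: 'r kpoly)"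
      for \<nu> L
    define lab where "lab w = (\<lambda>(K, G)\<in>(SIGMA K:T. K). card (snd w G K))"
      for w :: "(nat set \<Rightarrow> nat \<times> nat \<Rightarrow> nat \<times> nat) \<times> (nat set \<Rightarrow> nat set set \<Rightarrow> (nat \<times> nat) set)"
    have fin_cyc: "finite (cyc G \<nu>)" if "G \<in> \<pi>" for G \<nu>
      using finite_pts[OF finG[OF that]] by (simp add: cyc_def cycle_partition_def)
    have finN: "finite N" unfolding N_def using fin\<pi> finG by (intro finite_PiE finite_NSmu)
    have finM: "finite (M \<nu>)" for \<nu>
    proof -
      have "finite {l \<in> blue_at T G \<rightarrow>\<^sub>E cyc G (\<nu> G). inj_on l (blue_at T G)}" if "G \<in> \<pi>" for G
      proof (rule finite_subset)
        show "finite (blue_at T G \<rightarrow>\<^sub>E cyc G (\<nu> G))" using finS fin_cyc[OF that] by (intro finite_PiE)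
      qed auto
      then show ?thesis unfolding M_def using fin\<pi> by (intro finite_PiE)
    qed
    have fiber: "{L \<in> M \<nu>. lab (\<nu>, L) = j} =
        (\<Pi>\<^sub>E G\<in>\<pi>. marked_maps (blue_at T G) (cyc G (\<nu> G)) card (\<lambda>K. j (K, G)))"
      if j: "j \<in> edge_labels T" for j \<nu>
    proof -
      have lab_iff: "lab (\<nu>, L) = j \<longleftrightarrow> (\<forall>G\<in>\<pi>. \<forall>K\<in>blue_at T G. card (L G K) = j (K, G))" for L
      proof
        assume "lab (\<nu>, L) = j"
        then show "\<forall>G\<in>\<pi>. \<forall>K\<in>blue_at T G. card (L G K) = j (K, G)"
          by (auto simp: lab_def blue_at_def)
      next
        assume eq: "\<forall>G\<in>\<pi>. \<forall>K\<in>blue_at T G. card (L G K) = j (K, G)"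
        show "lab (\<nu>, L) = j"
        proof
          fix e
          show "lab (\<nu>, L) e = j e"
          proof (cases "e \<in> (SIGMA K:T. K)")
            case True
            then show ?thesis using eq T\<pi> by (auto simp: lab_def blue_at_def)
          next
            case False
            then show ?thesis
              using PiE_arb[OF j[unfolded edge_labels_def]] by (simp add: lab_def restrict_def)
          qed
        qed
      qed
      show ?thesis
        by (rule set_eqI) (simp only: M_def marked_maps_def PiE_iff mem_Collect_eq lab_iff, blast)
    qed
    define t where "t w = (\<Prod>K\<in>T. kappa (image_mset (\<lambda>G. lab w (K, G)) (mset_set K))) *
      (case w of (\<nu>, L) \<Rightarrow> rest \<nu> L)" for w
    have F: "?F j m = (\<Sum>w | w \<in> Sigma N M \<and> lab w = j. t w)" if j: "j \<in> edge_labels T" for j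
    proof -
      let ?k = "\<Prod>K\<in>T. kappa (image_mset (\<lambda>G. j (K, G)) (mset_set K)) :: 'r kpoly"
      have "series_prod \<pi> (?A j) m = (\<Prod>G\<in>\<pi>. \<Sum>\<nu>\<in>NSmu G (Poly_Mapping.lookup m).
          \<Sum>l\<in>marked_maps (blue_at T G) (cyc G \<nu>) card (\<lambda>K. j (K, G)).
          \<Prod>V\<in>cyc G \<nu> - l ` blue_at T G. kappa {#card V#})"
      proof -
        have "Poly_Mapping.keys (monomial_part G m) = G" if "G \<in> \<pi>" for G
          using that True Un by (auto simp: keys_monomial_part)
        then have "?A j G (monomial_part G m) = (\<Sum>\<nu>\<in>NSmu G (Poly_Mapping.lookup m).
            \<Sum>l\<in>marked_maps (blue_at T G) (cyc G \<nu>) card (\<lambda>K. j (K, G)).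
            \<Prod>V\<in>cyc G \<nu> - l ` blue_at T G. kappa {#card V#})" if "G \<in> \<pi>" for G
          using that by (simp add: A NSmu_monomial_part pts_monomial_part cyc_def)
        then show ?thesis unfolding prod_A using True by simp
      qed
      also have "\<dots> = (\<Sum>\<nu>\<in>N. \<Sum>L\<in>(\<Pi>\<^sub>E G\<in>\<pi>. marked_maps (blue_at T G) (cyc G (\<nu> G)) card (\<lambda>K. j (K, G))).
          rest \<nu> L)"
        unfolding N_def rest_def using fin\<pi> finG fin_cyc finS
        by (simp add: prod_sum_PiE finite_NSmu finite_marked_maps)
      also have "\<dots> = (\<Sum>\<nu>\<in>N. \<Sum>L | L \<in> M \<nu> \<and> lab (\<nu>, L) = j. rest \<nu> L)"
        using fiber[OF j] by simp
      also have "\<dots> = (\<Sum>(\<nu>, L)\<in>(SIGMA \<nu>:N. {L \<in> M \<nu>. lab (\<nu>, L) = j}). rest \<nu> L)"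
        using finN finM by (intro sum.Sigma) auto
      also have "(SIGMA \<nu>:N. {L \<in> M \<nu>. lab (\<nu>, L) = j}) = {w \<in> Sigma N M. lab w = j}" by blast
      finally have "?F j m = ?k * (\<Sum>w | w \<in> Sigma N M \<and> lab w = j. case w of (\<nu>, L) \<Rightarrow> rest \<nu> L)"
        by (simp add: series_scale_def)
      also have "\<dots> = (\<Sum>w | w \<in> Sigma N M \<and> lab w = j. t w)"
        unfolding sum_distrib_left by (intro sum.cong) (auto simp: t_def)
      finally show ?thesis .
    qed
    have lab_in: "lab ` Sigma N M \<subseteq> edge_labels T"
    proof (rule image_subsetI)
      fix w assume "w \<in> Sigma N M"
      then obtain \<nu> L where w_eq: "w = (\<nu>, L)" and w: "\<nu> \<in> N" "L \<in> M \<nu>" by (rule SigmaE)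
      have "card (L G K) \<ge> 1" if "K \<in> T" "G \<in> K" for K G
      proof -
        have G: "G \<in> \<pi>" using T\<pi>[OF that(1)] that(2) by blast
        then have "L G K \<in> cyc G (\<nu> G)" using w(2) that by (auto simp: M_def blue_at_def)
        moreover have "\<nu> G \<in> NSmu G (Poly_Mapping.lookup m)"
          using w(1) G unfolding N_def by (rule PiE_mem)
        then have "\<nu> G permutes pts G (Poly_Mapping.lookup m)"
          by (simp add: NSmu_def NS_def)
        ultimately have "card (L G K) > 0"
          using finite_pts[OF finG[OF G]]
          by (intro card_cycle_pos[of "pts G (Poly_Mapping.lookup m)" "\<nu> G"]) (simp_all add: cyc_def)
        then show ?thesis by simp
      qed
      then show "lab w \<in> edge_labels T"
        unfolding edge_labels_def lab_def restrict_PiE_iff by (simp add: w_eq split_beta mem_Sigma_iff)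
    qed
    have "Cbar I \<pi> T m = (\<Sum>\<nu>\<in>N. \<Sum>L\<in>M \<nu>.
        (\<Prod>K\<in>T. kappa (image_mset (\<lambda>G. card (L G K)) (mset_set K))) * rest \<nu> L)"
      using True by (simp add: Cbar_def series_pos_def N_def M_def rest_def cyc_def)
    also have "\<dots> = (\<Sum>(\<nu>, L)\<in>Sigma N M.
        (\<Prod>K\<in>T. kappa (image_mset (\<lambda>G. card (L G K)) (mset_set K))) * rest \<nu> L)"
      using finN finM by (intro sum.Sigma) auto
    also have "\<dots> = sum t (Sigma N M)"
      using finK
      by (intro sum.cong refl)
        (auto simp: t_def lab_def intro!: arg_cong2[of _ _ _ _ "(*)"] prod.cong arg_cong[of _ _ kappa] image_mset_cong)
    finally have "Cbar I \<pi> T m = sum t (Sigma N M)" .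
    moreover have "finite (Sigma N M)" using finN finM by (rule finite_SigmaI)
    ultimately show ?thesis
      using sum_fibers[of "Sigma N M" lab "edge_labels T" "\<lambda>j. ?F j m" t] lab_in F by simp
  qed
  then show ?thesis by (simp add: has_formal_sum_def)
qed

end
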